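(* In a non-stationary environment, let $t_m,t_{m+1}$ be integer times in $[0,T]$ with $t_{m+1}-t_m\ge2$. For integers $G_m,N_m\ge0$ with $G_m+N_m=t_{m+1}-t_m$ consider $$\bar B(t_m,t_{m+1})=C_4\big(\bar B_r(t_m,t_m+G_m)+\bar B_r(t_m+G_m,t_{m+1})\big)+C_5\big(\bar B_p(t_m,t_m+G_m)+\bar B_p(t_m+G_m,t_{m+1})\big)$$ as a function of $N_m\in\{0,1,\dots,t_{m+1}-t_m\}$ (with $G_m=t_{m+1}-t_m-N_m$). Then there exists $N_m$ in the open interval $(0,t_{m+1}-t_m)$ that minimizes $\bar B(t_m,t_{m+1})$.
   Context: $\mathcal S,\mathcal A$ are finite sets, $\gamma\in(0,1)$, $H\in\mathbb N$. For each integer time $t\in[0,T]$ there are a transition kernel $P_t(\cdot\mid s,a)\in\Delta(\mathcal S)$ and a reward $R_t:\mathcal S\times\mathcal A\to\mathbb R$; $r_{\max}=\max_{t,s,a}|R_t(s,a)|$. For integers $t_1\le t_2$, the local variation budgets are $B_r(t_1,t_2)=\sum_{t=t_1}^{t_2-1}\max_{s,a}|R_{t+1}(s,a)-R_t(s,a)|$ and $B_p(t_1,t_2)=\sum_{t=t_1}^{t_2-1}\max_{s,a}\|P_{t+1}(\cdot\mid s,a)-P_t(\cdot\mid s,a)\|_1$, and the cumulative variation budgets are $\bar B_r(t_1,t_2)=\sum_{t=t_1}^{t_2-1}B_r(t_1,t)$, $\bar B_p(t_1,t_2)=\sum_{t=t_1}^{t_2-1}B_p(t_1,t)$ (empty sums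 are $0$). The environment is non-stationary if there exist $t_1,t_2\in[0,T]$ with $B_r(t_1,t_2)>0$ or $B_p(t_1,t_2)>0$. The constants are $C_4=\frac{2(1-\gamma^H)}{1-\gamma}$ and $C_5=\frac{\gamma}{1-\gamma}\big(\frac{1-\gamma^H}{1-\gamma}-\gamma^{H-1}H\big)+\frac{1-\gamma^H}{1-\gamma}\cdot\frac{r_{\max}}{1-\gamma}$. *)

theory Defs
  imports Complex_Main "HOL-Probability.Probability_Mass_Function"
begin

text \<open>
  The finite state and action sets are types of class \<open>finite\<close> (hence nonempty, as the maxima below
  require). Transition kernels and rewards are families indexed by integer times
  \<open>t \<ge> 0\<close>; only the values at \<open>t \<le> T\<close> are ever used.
\<close>

type_synonym ('s, 'a) kernels = "nat \<Rightarrow> 's \<Rightarrow> 'a \<Rightarrow> 's pmf"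
type_synonym ('s, 'a) rewards = "nat \<Rightarrow> 's \<Rightarrow> 'a \<Rightarrow> real"

definition r_max :: "('s::finite, 'a::finite) rewards \<Rightarrow> nat \<Rightarrow> real" where
  "r_max R T = (MAX (t, s, a) \<in> {0..T} \<times> UNIV \<times> UNIV. \<bar>R t s a\<bar>)"

definition l1_dist :: "'s::finite pmf \<Rightarrow> 's pmf \<Rightarrow> real" where
  "l1_dist p q = (\<Sum>x\<in>UNIV. \<bar>pmf p x - pmf q x\<bar>)"

definition B_r :: "('s::finite, 'a::finite) rewards \<Rightarrow> nat \<Rightarrow> nat \<Rightarrow> real" where
  "B_r R t1 t2 = (\<Sum>t\<in>{t1..<t2}. MAX (s, a) \<in> UNIV. \<bar>R (t + 1) s a - R t s a\<bar>)"

definition B_p :: "('s::finite, 'a::finite) kernels \<Rightarrow> nat \<Rightarrow> nat \<Rightarrow> real" where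
  "B_p P t1 t2 = (\<Sum>t\<in>{t1..<t2}. MAX (s, a) \<in> UNIV. l1_dist (P (t + 1) s a) (P t s a))"

definition cum_B_r :: "('s::finite, 'a::finite) rewards \<Rightarrow> nat \<Rightarrow> nat \<Rightarrow> real" where
  "cum_B_r R t1 t2 = (\<Sum>t\<in>{t1..<t2}. B_r R t1 t)"

definition cum_B_p :: "('s::finite, 'a::finite) kernels \<Rightarrow> nat \<Rightarrow> nat \<Rightarrow> real" where
  "cum_B_p P t1 t2 = (\<Sum>t\<in>{t1..<t2}. B_p P t1 t)"

definition nonstationary ::
  "('s::finite, 'a::finite) kernels \<Rightarrow> ('s, 'a) rewards \<Rightarrow> nat \<Rightarrow> bool" where
  "nonstationary P R T \<longleftrightarrow>
     (\<exists>t1 t2. t1 \<le> t2 \<and> t2 \<le> T \<and> (B_r R t1 t2 > 0 \<or> B_p P t1 t2 > 0))"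

definition C4 :: "real \<Rightarrow> nat \<Rightarrow> real" where
  "C4 \<gamma> H = 2 * (1 - \<gamma> ^ H) / (1 - \<gamma>)"

text \<open>
  The truncated exponent \<open>H - 1\<close> is harmless at \<open>H = 0\<close>, since that term carries the factor \<open>H\<close>.
\<close>

definition C5 :: "real \<Rightarrow> nat \<Rightarrow> real \<Rightarrow> real" where
  "C5 \<gamma> H rmax =
     \<gamma> / (1 - \<gamma>) * ((1 - \<gamma> ^ H) / (1 - \<gamma>) - \<gamma> ^ (H - 1) * real H)
     + (1 - \<gamma> ^ H) / (1 - \<gamma>) * (rmax / (1 - \<gamma>))"

text \<open>
  The objective as a function of \<open>N\<close>, with \<open>G = tm1 - tm - N\<close>; meaningful for \<open>tm \<le> tm1\<close> and
  \<open>N \<le> tm1 - tm\<close>, where the subtractions on \<open>nat\<close> do not truncate.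
\<close>

definition B_bar ::
  "('s::finite, 'a::finite) kernels \<Rightarrow> ('s, 'a) rewards \<Rightarrow> nat \<Rightarrow> real \<Rightarrow> nat \<Rightarrow>
   nat \<Rightarrow> nat \<Rightarrow> nat \<Rightarrow> real" where
  "B_bar P R T \<gamma> H tm tm1 N =
     (let G = tm1 - tm - N in
        C4 \<gamma> H * (cum_B_r R tm (tm + G) + cum_B_r R (tm + G) tm1)
        + C5 \<gamma> H (r_max R T) * (cum_B_p P tm (tm + G) + cum_B_p P (tm + G) tm1))"

end

theory Submission imports Defs begin

text \<open>
  At both ends \<open>N = 0\<close> and \<open>N = tm1 - tm\<close> one of the two pieces is empty, so the objective takes the
  same value there, namely that of the unsplit interval. Splitting never increases a cumulative
  budget, because restarting the inner sum at the split point drops nonnegative terms. As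
  \<open>C4\<close> and \<open>C5\<close> are nonnegative, an interior point is at least as good as either end.
\<close>

text \<open>Common core of the two budget inequalities: \<open>v i\<close> stands for the maximal
  one-step change at time \<open>i\<close>, of the rewards or of the kernels.\<close>

lemma double_sum_split_le:
  fixes v :: "nat \<Rightarrow> real"
  assumes nonneg: "\<And>i. 0 \<le> v i" and "a \<le> m" "m \<le> b"
  shows "(\<Sum>t\<in>{a..<m}. sum v {a..<t}) + (\<Sum>t\<in>{m..<b}. sum v {m..<t})
         \<le> (\<Sum>t\<in>{a..<b}. sum v {a..<t})"
proof -
  have "(\<Sum>t\<in>{m..<b}. sum v {m..<t}) \<le> (\<Sum>t\<in>{m..<b}. sum v {a..<t})"
    using assms by (intro sum_mono sum_mono2) auto
  moreover have "(\<Sum>t\<in>{a..<m}. sum v {a..<t}) + (\<Sum>t\<in>{m..<b}. sum v {a..<t})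
      = (\<Sum>t\<in>{a..<b}. sum v {a..<t})"
    using assms by (intro sum.atLeastLessThan_concat)
  ultimately show ?thesis by linarith
qed

lemma Max_image_nonneg:
  fixes f :: "'b \<Rightarrow> real"
  assumes "finite A" "A \<noteq> {}" "\<And>x. x \<in> A \<Longrightarrow> 0 \<le> f x"
  shows "0 \<le> Max (f ` A)"
  using assms by (subst Max_ge_iff) auto

lemma l1_dist_nonneg: "0 \<le> l1_dist p q"
  unfolding l1_dist_def by (intro sum_nonneg) simp

lemma r_max_nonneg: "0 \<le> r_max R T"
  unfolding r_max_def by (intro Max_image_nonneg) auto

lemma cum_B_r_split_le:
  assumes "a \<le> m" "m \<le> b"
  shows "cum_B_r R a m + cum_B_r R m b \<le> cum_B_r R a b"
  unfolding cum_B_r_def B_r_def using assms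
  by (intro double_sum_split_le Max_image_nonneg) auto

lemma cum_B_p_split_le:
  assumes "a \<le> m" "m \<le> b"
  shows "cum_B_p P a m + cum_B_p P m b \<le> cum_B_p P a b"
  unfolding cum_B_p_def B_p_def using assms
  by (intro double_sum_split_le Max_image_nonneg) (auto intro: l1_dist_nonneg)

lemma C4_nonneg:
  assumes "0 < \<gamma>" "\<gamma> < 1"
  shows "0 \<le> C4 \<gamma> H"
  using assms by (simp add: C4_def power_le_one)

text \<open>The right side is the sum of \<open>\<gamma> ^ i\<close> over \<open>i < H\<close>, and
  each of its \<open>H\<close> terms is at least the last one, \<open>\<gamma> ^ (H - 1)\<close>.
  For \<open>H = 0\<close> both sides vanish. This gives the sign of the bracketed difference in
  \<open>C5\<close>.\<close>

lemma geometric_sum_ge_last_term: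
  fixes \<gamma> :: real
  assumes "0 < \<gamma>" "\<gamma> < 1"
  shows "\<gamma> ^ (H - 1) * real H \<le> (1 - \<gamma> ^ H) / (1 - \<gamma>)"
proof -
  have "(\<Sum>i<H. \<gamma> ^ (H - 1)) \<le> (\<Sum>i<H. \<gamma> ^ i)"
    using assms by (intro sum_mono power_decreasing) auto
  then show ?thesis
    using assms by (simp add: sum_gp_strict mult.commute)
qed

lemma C5_nonneg:
  assumes "0 < \<gamma>" "\<gamma> < 1" "0 \<le> rmax"
  shows "0 \<le> C5 \<gamma> H rmax"
  using assms geometric_sum_ge_last_term[of \<gamma> H]
  unfolding C5_def by (intro add_nonneg_nonneg mult_nonneg_nonneg) (auto simp: power_le_one)

lemma B_bar_le_ends:
  assumes "0 < \<gamma>" "\<gamma> < 1" "tm \<le> tm1" and M: "M \<in> {0, tm1 - tm}"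
  shows "B_bar P R T \<gamma> H tm tm1 N \<le> B_bar P R T \<gamma> H tm tm1 M"
proof -
  have "B_bar P R T \<gamma> H tm tm1 M
      = C4 \<gamma> H * cum_B_r R tm tm1 + C5 \<gamma> H (r_max R T) * cum_B_p P tm tm1"
    using M \<open>tm \<le> tm1\<close> by (auto simp: B_bar_def cum_B_r_def cum_B_p_def)
  moreover have "B_bar P R T \<gamma> H tm tm1 N
      \<le> C4 \<gamma> H * cum_B_r R tm tm1 + C5 \<gamma> H (r_max R T) * cum_B_p P tm tm1"
    \<comment> \<open>Truncated subtraction keeps \<open>tm + G\<close> between \<open>tm\<close>
      and \<open>tm1\<close> for every \<open>N\<close>, so both splitting inequalities apply at the
      point \<open>tm + G\<close>.\<close>
    unfolding B_bar_def Let_def using assms(1-3)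
    by (intro add_mono mult_left_mono cum_B_r_split_le cum_B_p_split_le
        C4_nonneg C5_nonneg r_max_nonneg) auto
  ultimately show ?thesis by simp
qed

theorem proposition5p6:
  fixes P :: "('s::finite, 'a::finite) kernels"
    and R :: "('s, 'a) rewards"
    and T H tm tm1 :: nat
    and \<gamma> :: real
  assumes "0 < \<gamma>" and "\<gamma> < 1"
    and "nonstationary P R T"
    and "tm \<le> T" and "tm1 \<le> T"
    and "tm + 2 \<le> tm1"
  shows "\<exists>N \<in> {0<..<tm1 - tm}.
           is_arg_min (B_bar P R T \<gamma> H tm tm1) (\<lambda>N'. N' \<in> {0..tm1 - tm}) N"
proof -
  let ?f = "B_bar P R T \<gamma> H tm tm1"
  let ?I = "{0<..<tm1 - tm}"
  \<comment> \<open>Length at least 2 puts \<open>1\<close> strictly inside, so a minimizer over the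
    interior exists.\<close>
  have I: "finite ?I" "1 \<in> ?I" using assms(6) by auto
  then obtain N where N: "is_arg_min ?f (\<lambda>x. x \<in> ?I) N"
    using ex_is_arg_min_if_finite[of ?I ?f] by blast
  have "?f N \<le> ?f M" if "M \<in> {0..tm1 - tm}" for M
  proof (cases "M \<in> ?I")
    case True
    then show ?thesis using N by (simp add: is_arg_min_linorder)
  next
    case False
    \<comment> \<open>Only the two ends remain, and neither has a smaller value than the interior
      minimizer.\<close>
    then have "M \<in> {0, tm1 - tm}" using that by auto
    then show ?thesis using assms by (intro B_bar_le_ends) auto
  qed
  then show ?thesis
    using N by (intro bexI[of _ N]) (auto simp: is_arg_min_linorder)
qed

end
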